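(* Let $p$ be a prime and $G$ an infinite abelian group in which every nonzero element has order $p$. (i) For every integer $h\geq p$, $X_G(h)\leq ph+p-1$. (ii) For every integer $h\geq 3(p-1)/2$, $X_G(h)\geq 2h-3p+3$. In particular, if $p=2$ then $X_G(h)\sim 2h$ as $h\to\infty$.
   Context: For $A\subset G$ and a positive integer $h$, $hA$ is the set of sums of $h$ not necessarily distinct elements of $A$; $A\sim B$ means finite symmetric difference. $\operatorname{ord}^*_G(A)$ is the least $k$ with $kA\sim G$ ($\infty$ if none). $A$ is a basis if $\operatorname{ord}^*_G(A)<\infty$. For a basis $A$, $a\in A$ is regular if $A\setminus\{a\}$ is still a basis; $A^*$ is the set of regular elements. $X_G(h)=\sup\{\operatorname{ord}^*_G(A\setminus\{a\}) : A\subset G,\ hA\sim G,\ a\in A^*\}$. *)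

theory Defs
  imports
    Complex_Main
    "HOL-Library.Extended_Nat"
    "HOL-Library.Landau_Symbols"
    "HOL-Computational_Algebra.Primes"
begin

definition nfold_sumset :: "nat \<Rightarrow> 'a::comm_monoid_add set \<Rightarrow> 'a set" where
  "nfold_sumset h A = {sum_list xs | xs. length xs = h \<and> set xs \<subseteq> A}"

definition almost_equal :: "'a set \<Rightarrow> 'a set \<Rightarrow> bool" where
  "almost_equal A B \<longleftrightarrow> finite (sym_diff A B)"

text \<open>The infimum of the empty set in \<^typ>\<open>enat\<close> is \<open>\<infinity>\<close>.\<close>

definition ord_star :: "'a::ab_group_add set \<Rightarrow> enat" where
  "ord_star A = (INF k \<in> {k. 0 < k \<and> almost_equal (nfold_sumset k A) UNIV}. enat k)"

definition is_basis :: "'a::ab_group_add set \<Rightarrow> bool" where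
  "is_basis A \<longleftrightarrow> ord_star A < \<infinity>"

definition regular_elements :: "'a::ab_group_add set \<Rightarrow> 'a set" where
  "regular_elements A = {a \<in> A. is_basis (A - {a})}"

text \<open>The ambient group is the whole type \<open>'a\<close>, passed as a type argument.\<close>

definition X_fun :: "'a::ab_group_add itself \<Rightarrow> nat \<Rightarrow> enat" where
  "X_fun (G :: 'a itself) h =
     Sup {ord_star (A - {a}) | (A :: 'a set) a.
            almost_equal (nfold_sumset h A) UNIV \<and> a \<in> regular_elements A}"

text \<open>Order of an element of an additive group, with value 0 for infinite order.\<close>

definition add_order :: "'a::ab_group_add \<Rightarrow> nat" where
  "add_order x =
     (if \<exists>n>0. sum_list (replicate n x) = 0
      then LEAST n. 0 < n \<and> sum_list (replicate n x) = 0 else 0)"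

end

theory Submission
  imports Defs "HOL-Number_Theory.Cong" "HOL-Library.FuncSet"
begin

text \<open>
  Upper bound. Pick \<open>b \<in> A - {a}\<close> and put \<open>B = (A - {a}) - b\<close>, which contains \<open>0\<close>, and \<open>e = b - a\<close>.
  Then \<open>hA \<sim> G\<close> says that \<open>hB\<close> meets almost every coset of the line \<open>\<langle>e\<rangle>\<close>. If \<open>(h + 1)B\<close> contains two
  points of one such coset, then \<open>(p - 1)(h + 1)B\<close> contains a whole coset, hence
  \<open>(ph + p - 1)B \<sim> G\<close>. Otherwise \<open>hB\<close> and \<open>hB + b'\<close>, both subsets of \<open>(h + 1)B\<close>, agree up to a finite set for
  every \<open>b' \<in> B\<close>; since \<open>B\<close> is a basis the same holds for \<open>hB + e\<close>, although \<open>hB\<close> is infinite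
  and disjoint from \<open>hB + e\<close>.

  Lower bound. Split \<open>G = \<langle>v\<^sub>1, \<dots>, v\<^sub>n\<rangle> \<oplus> I\<close> with \<open>v\<^sub>i\<close> independent, and let \<open>B = I \<union> {v\<^sub>1, \<dots>, v\<^sub>n}\<close> and
  \<open>e = v\<^sub>1 + \<dots> + v\<^sub>n\<close>. An element with all coordinates equal to \<open>p - 1\<close> and a nonzero
  component in \<open>I\<close> needs \<open>n(p - 1) + 1\<close> summands from \<open>B\<close>, but averaging over the line \<open>\<langle>e\<rangle>\<close> shows that every
  coset of it contains an element that needs at most \<open>n(p - 1)/2 + 1\<close> summands. So
  \<open>A = B \<union> {- e}\<close> has order about half that of \<open>B\<close>.
\<close>

section \<open>Iterated sumsets\<close>

lemma nfold_sumset_0 [simp]: "nfold_sumset 0 A = {0}"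
  by (auto simp: nfold_sumset_def)

lemma nfold_sumset_Suc:
  "nfold_sumset (Suc k) A = {a + y | a y. a \<in> A \<and> y \<in> nfold_sumset k A}" (is "?l = ?r")
proof
  show "?l \<subseteq> ?r"
  proof
    fix x assume "x \<in> ?l"
    then obtain xs where xs: "x = sum_list xs" "length xs = Suc k" "set xs \<subseteq> A"
      by (auto simp: nfold_sumset_def)
    then obtain a ys where "xs = a # ys" by (cases xs) auto
    with xs show "x \<in> ?r" by (auto simp: nfold_sumset_def)
  qed
  show "?r \<subseteq> ?l"
  proof
    fix x assume "x \<in> ?r"
    then obtain a ys where "x = a + sum_list ys" "a \<in> A" "length ys = k" "set ys \<subseteq> A"
      by (auto simp: nfold_sumset_def)
    then have "x = sum_list (a # ys)" "length (a # ys) = Suc k" "set (a # ys) \<subseteq> A" by auto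
    then show "x \<in> ?l" unfolding nfold_sumset_def by blast
  qed
qed

lemma nfold_sumset_1 [simp]: "nfold_sumset (Suc 0) A = A"
  by (auto simp: nfold_sumset_Suc)

lemma nfold_sumset_add:
  assumes "x \<in> nfold_sumset k A" "y \<in> nfold_sumset l A"
  shows "x + y \<in> nfold_sumset (k + l) A"
proof -
  obtain xs ys where "x = sum_list xs" "length xs = k" "set xs \<subseteq> A"
    "y = sum_list ys" "length ys = l" "set ys \<subseteq> A"
    using assms by (auto simp: nfold_sumset_def)
  then have "x + y = sum_list (xs @ ys)" "length (xs @ ys) = k + l" "set (xs @ ys) \<subseteq> A" by auto
  then show ?thesis unfolding nfold_sumset_def by blast
qed

lemma nfold_sumset_mono: "A \<subseteq> B \<Longrightarrow> nfold_sumset k A \<subseteq> nfold_sumset k B"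
  unfolding nfold_sumset_def by blast

lemma zero_in_nfold_sumset: "0 \<in> A \<Longrightarrow> 0 \<in> nfold_sumset k A"
  by (induction k) (auto simp: nfold_sumset_Suc intro: exI[of _ 0])

lemma nfold_sumset_le_mono:
  assumes "0 \<in> A" "k \<le> l" shows "nfold_sumset k A \<subseteq> nfold_sumset l A"
proof
  fix x assume "x \<in> nfold_sumset k A"
  from nfold_sumset_add[OF this zero_in_nfold_sumset[OF assms(1), of "l - k"]] assms(2)
  show "x \<in> nfold_sumset l A" by simp
qed

lemma nfold_sumset_sum:
  assumes "finite S" "\<And>i. i \<in> S \<Longrightarrow> f i \<in> nfold_sumset (k i) A"
  shows "sum f S \<in> nfold_sumset (sum k S) A"
  using assms by (induction S rule: finite_induct) (auto intro: nfold_sumset_add)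

section \<open>Orders and bases in terms of cofinite sumsets\<close>

lemma almost_equal_UNIV: "almost_equal S UNIV \<longleftrightarrow> finite (- S)"
  unfolding almost_equal_def by (simp add: Compl_eq_Diff_UNIV)

lemma ord_star_le: "0 < k \<Longrightarrow> finite (- nfold_sumset k A) \<Longrightarrow> ord_star A \<le> enat k"
  unfolding ord_star_def by (intro INF_lower) (simp add: almost_equal_UNIV)

lemma le_ord_star:
  "(\<And>k. 0 < k \<Longrightarrow> finite (- nfold_sumset k A) \<Longrightarrow> m \<le> k) \<Longrightarrow> enat m \<le> ord_star A"
  unfolding ord_star_def by (intro INF_greatest) (simp add: almost_equal_UNIV)

lemma is_basis_iff: "is_basis A \<longleftrightarrow> (\<exists>k>0. finite (- nfold_sumset k A))"
proof
  assume "is_basis A"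
  then have "{k. 0 < k \<and> almost_equal (nfold_sumset k A) UNIV} \<noteq> {}"
    unfolding is_basis_def ord_star_def by (metis image_empty Inf_empty top_enat_def less_irrefl)
  then show "\<exists>k>0. finite (- nfold_sumset k A)" by (auto simp: almost_equal_UNIV)
next
  assume "\<exists>k>0. finite (- nfold_sumset k A)"
  then obtain k where "ord_star A \<le> enat k" using ord_star_le by blast
  then show "is_basis A" unfolding is_basis_def using enat_ord_simps(4) order.strict_trans1 by blast
qed

lemma X_fun_ge:
  fixes A :: "'a::ab_group_add set"
  assumes "finite (- nfold_sumset h A)" "a \<in> regular_elements A"
  shows "ord_star (A - {a}) \<le> X_fun TYPE('a) h"
  unfolding X_fun_def using assms by (intro Sup_upper) (auto simp: almost_equal_UNIV)

section \<open>Natural multiples\<close>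

text \<open>The same expression as in \<open>add_order\<close>, so that the order hypothesis turns
  directly into \<open>nmul p x = 0\<close>.\<close>

definition nmul :: "nat \<Rightarrow> 'a::ab_group_add \<Rightarrow> 'a" where
  "nmul k x = sum_list (replicate k x)"

lemma nmul_0 [simp]: "nmul 0 x = 0" and nmul_Suc: "nmul (Suc k) x = x + nmul k x"
  by (simp_all add: nmul_def)

lemma nmul_1 [simp]: "nmul (Suc 0) x = x" by (simp add: nmul_Suc)

lemma nmul_zero [simp]: "nmul k 0 = 0" by (induction k) (simp_all add: nmul_Suc)

lemma nmul_add: "nmul (k + l) x = nmul k x + nmul l x"
  by (induction k) (simp_all add: nmul_Suc algebra_simps)

lemma nmul_add_right: "nmul k (x + y) = nmul k x + nmul k y"
  by (induction k) (simp_all add: nmul_Suc algebra_simps)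

lemma nmul_minus_right: "nmul k (- x) = - nmul k x"
  by (induction k) (simp_all add: nmul_Suc algebra_simps)

lemma nmul_mult: "nmul (k * l) x = nmul k (nmul l x)"
  by (induction k) (simp_all add: nmul_Suc nmul_add)

lemma nmul_in_nfold_sumset: "x \<in> nfold_sumset l A \<Longrightarrow> nmul k x \<in> nfold_sumset (k * l) A"
  by (induction k) (auto simp: nmul_Suc intro: nfold_sumset_add)

lemma nfold_sumset_translate: "nfold_sumset k ((+) c ` A) = (+) (nmul k c) ` nfold_sumset k A"
proof (induction k)
  case (Suc k)
  show ?case
  proof (intro set_eqI iffI)
    fix x assume "x \<in> nfold_sumset (Suc k) ((+) c ` A)"
    then obtain a y where "a \<in> A" "y \<in> nfold_sumset k A" "x = (c + a) + (nmul k c + y)"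
      by (auto simp: nfold_sumset_Suc Suc.IH)
    then show "x \<in> (+) (nmul (Suc k) c) ` nfold_sumset (Suc k) A"
      by (intro image_eqI[of _ _ "a + y"]) (auto simp: nfold_sumset_Suc nmul_Suc algebra_simps)
  next
    fix x assume "x \<in> (+) (nmul (Suc k) c) ` nfold_sumset (Suc k) A"
    then obtain a y where *: "a \<in> A" "y \<in> nfold_sumset k A" "x = nmul (Suc k) c + (a + y)"
      by (auto simp: nfold_sumset_Suc)
    then have "x = (c + a) + (nmul k c + y)" by (simp add: nmul_Suc algebra_simps)
    with * show "x \<in> nfold_sumset (Suc k) ((+) c ` A)"
      by (auto simp: nfold_sumset_Suc Suc.IH)
  qed
qed simp

lemma finite_compl_translate: "finite (- ((+) c ` S)) \<longleftrightarrow> finite (- S)" for c :: "'a::ab_group_add"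
proof -
  have "- ((+) c ` S) = (+) c ` (- S)" by (rule translation_Compl[symmetric])
  then show ?thesis by (simp add: finite_image_iff)
qed

section \<open>Infinite abelian groups of prime exponent\<close>

locale elementary_abelian =
  fixes p :: nat and G :: "'a::ab_group_add itself"
  assumes prime_p: "prime p"
    and infinite_UNIV: "infinite (UNIV :: 'a set)"
    and nmul_p [simp]: "nmul p (x :: 'a) = 0"
begin

lemma p_gt_1: "1 < p"
  using prime_p prime_gt_1_nat by blast

lemma nmul_mod: "nmul (k mod p) (x :: 'a) = nmul k x"
proof -
  have "nmul k x = nmul (k div p * p + k mod p) x" by simp
  also have "\<dots> = nmul (k mod p) x" by (simp only: nmul_add nmul_mult) simp
  finally show ?thesis by simp
qed

lemma uminus_eq_nmul: "- x = nmul (p - 1) (x :: 'a)"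
proof -
  have "x + nmul (p - 1) x = nmul (Suc (p - 1)) x" by (simp only: nmul_Suc)
  then show ?thesis using p_gt_1 by (simp add: minus_unique)
qed

lemma nmul_inverse:
  assumes "0 < k" "k < p"
  obtains l where "\<And>x::'a. nmul l (nmul k x) = x"
proof -
  have "coprime k p"
    using assms prime_p by (metis coprime_commute nat_dvd_not_less prime_imp_coprime)
  then obtain l where "[k * l = 1] (mod p)" using cong_solve_coprime_nat by force
  then have "(l * k) mod p = 1" using p_gt_1 by (simp add: cong_def mult.commute)
  then have "nmul l (nmul k x) = x" for x :: 'a
    using nmul_mod[of "l * k" x] by (simp add: nmul_mult)
  then show ?thesis using that by blast
qed

lemma cofinite_inter_nonempty:
  assumes "finite (- S)" "finite (- T)" shows "S \<inter> (T :: 'a set) \<noteq> {}"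
proof
  assume "S \<inter> T = {}"
  then have "UNIV = - S \<union> - T" by auto
  with assms infinite_UNIV show False by (metis finite_Un)
qed

text \<open>A cofinite \<open>S\<close> meets \<open>x - S\<close> for every \<open>x\<close>,
  because the group is infinite. This makes every element, not only almost every one, a sum of
  elements of a basis.\<close>

lemma cofinite_nfold_double:
  assumes "finite (- nfold_sumset k (A :: 'a set))"
  shows "nfold_sumset (k + k) A = UNIV"
proof -
  let ?S = "nfold_sumset k A"
  have "x \<in> nfold_sumset (k + k) A" for x
  proof -
    have "- ((-) x ` ?S) \<subseteq> (-) x ` (- ?S)"
    proof
      fix y assume "y \<in> - ((-) x ` ?S)"
      then have "x - y \<notin> ?S" by (auto simp: image_iff)
      then show "y \<in> (-) x ` (- ?S)" by (intro image_eqI[of _ _ "x - y"]) auto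
    qed
    then have "finite (- ((-) x ` ?S))" using assms finite_surj by blast
    from cofinite_inter_nonempty[OF assms this] obtain s where "s \<in> ?S" "x - s \<in> ?S" by auto
    from nfold_sumset_add[OF this] show ?thesis by simp
  qed
  then show ?thesis by blast
qed

section \<open>The upper bound\<close>

text \<open>A summand \<open>a\<close> leaves only the constant \<open>a\<close>; any other summand
  is \<open>y = a + (b - a) + (y - b)\<close>. So \<open>i\<close> counts the summands other than
  \<open>a\<close>, and zeros pad the rest.\<close>

lemma nfold_sumset_insert_subset:
  fixes a b :: 'a
  assumes "b \<in> A - {a}" "x \<in> nfold_sumset h A"
  shows "\<exists>i. \<exists>d \<in> nfold_sumset h ((+) (- b) ` (A - {a})). x = nmul h a + nmul i (b - a) + d"
  using assms(2)
proof (induction h arbitrary: x)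
  case 0
  then show ?case by (auto intro: exI[of _ 0])
next
  case (Suc h)
  let ?B = "(+) (- b) ` (A - {a})"
  from Suc.prems obtain y z where yz: "y \<in> A" "z \<in> nfold_sumset h A" "x = y + z"
    by (auto simp: nfold_sumset_Suc)
  from Suc.IH[OF yz(2)] obtain i d where
    d: "d \<in> nfold_sumset h ?B" "z = nmul h a + nmul i (b - a) + d" by blast
  show ?case
  proof (cases "y = a")
    case True
    have "0 \<in> ?B" using assms(1) by force
    with d(1) have "d \<in> nfold_sumset (Suc h) ?B"
      using nfold_sumset_le_mono[of ?B h "Suc h"] by auto
    moreover have "x = nmul (Suc h) a + nmul i (b - a) + d"
      using yz d True by (simp add: nmul_Suc algebra_simps)
    ultimately show ?thesis by blast
  next
    case False
    then have "- b + y \<in> ?B" using yz by blast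
    then have "(- b + y) + d \<in> nfold_sumset (Suc h) ?B" using d(1) unfolding nfold_sumset_Suc by blast
    moreover have "x = nmul (Suc h) a + nmul (Suc i) (b - a) + ((- b + y) + d)"
      using yz d by (simp add: nmul_Suc algebra_simps)
    ultimately show ?thesis by blast
  qed
qed

text \<open>Take \<open>j\<close> copies of \<open>u + f\<close> and \<open>k - j\<close> copies of
  \<open>u\<close>. For \<open>k = p - 1\<close> these points fill a coset of the line of
  \<open>f\<close>.\<close>

lemma multiples_in_nfold_sumset:
  fixes u f :: 'a
  assumes "u \<in> nfold_sumset l A" "u + f \<in> nfold_sumset l A" "j \<le> k"
  shows "nmul k u + nmul j f \<in> nfold_sumset (k * l) A"
proof -
  have "nmul j (u + f) + nmul (k - j) u \<in> nfold_sumset (j * l + (k - j) * l) A"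
    using assms by (intro nfold_sumset_add nmul_in_nfold_sumset)
  moreover have "nmul j (u + f) + nmul (k - j) u = nmul (j + (k - j)) u + nmul j f"
    by (simp only: nmul_add nmul_add_right) (simp add: algebra_simps)
  moreover have "j * l + (k - j) * l = k * l"
    using assms(3) by (metis add_mult_distrib le_add_diff_inverse)
  ultimately show ?thesis using assms(3) by simp
qed

text \<open>The set in \<open>cov\<close> adjoins all multiples of \<open>e\<close>, which stand for
  the removed element; the conclusion dispenses with them at the price of more summands.\<close>

lemma cofinite_of_cofinite_mod_line:
  fixes B :: "'a set" and e :: 'a
  assumes zero: "0 \<in> B" and basis: "finite (- nfold_sumset m B)"
    and cov: "finite (- {nmul i e + d | i d. d \<in> nfold_sumset h B})"
  shows "finite (- nfold_sumset (p * h + p - 1) B)"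
proof (cases "\<exists>u k. 0 < k \<and> k < p \<and> u \<in> nfold_sumset (Suc h) B \<and> u + nmul k e \<in> nfold_sumset (Suc h) B")
  case True
  define C where "C = {nmul i e + d | i d. d \<in> nfold_sumset h B}"
  from True obtain u k where uk: "0 < k" "k < p" "u \<in> nfold_sumset (Suc h) B"
    "u + nmul k e \<in> nfold_sumset (Suc h) B" by blast
  obtain l where l: "\<And>x::'a. nmul l (nmul k x) = x" using nmul_inverse uk by blast
  have "(+) (nmul (p - 1) u) ` C \<subseteq> nfold_sumset (p * h + p - 1) B"
  proof
    fix x assume "x \<in> (+) (nmul (p - 1) u) ` C"
    then obtain i d where x: "x = nmul (p - 1) u + (nmul i e + d)" "d \<in> nfold_sumset h B"
      by (auto simp: C_def)
    \<comment> \<open>\<open>l\<close> inverts \<open>k\<close> modulo \<open>p\<close>, so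
      \<open>j\<close> steps of \<open>nmul k e\<close> amount to \<open>i\<close> steps of
      \<open>e\<close>, with \<open>j\<close> at most \<open>p - 1\<close>.\<close>
    define j where "j = (i * l) mod p"
    have "nmul j (nmul k e) = nmul i e" by (simp add: j_def nmul_mod nmul_mult l)
    moreover have "j \<le> p - 1" using p_gt_1 mod_less_divisor[of p "i * l"] unfolding j_def by linarith
    ultimately have "nmul (p - 1) u + nmul i e \<in> nfold_sumset ((p - 1) * Suc h) B"
      using multiples_in_nfold_sumset[OF uk(3,4), of j "p - 1"] by simp
    from nfold_sumset_add[OF this x(2)] x(1)
    have "x \<in> nfold_sumset ((p - 1) * Suc h + h) B" by (simp add: add.assoc)
    \<comment> \<open>The first term fills a coset of the line and \<open>h\<close> further summands
      select which one.\<close>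
    moreover have "(p - 1) * Suc h + h = p * h + p - 1"
      using p_gt_1 by (cases p) auto
    ultimately show "x \<in> nfold_sumset (p * h + p - 1) B" by simp
  qed
  moreover have "finite (- ((+) (nmul (p - 1) u) ` C))"
    using cov by (simp add: finite_compl_translate C_def)
  ultimately show ?thesis by (meson Compl_anti_mono finite_subset)
next
  case False
  \<comment> \<open>Now distinct points of \<open>(h + 1)B\<close> lie in distinct cosets of the
    line. \<open>M\<close> collects the points whose coset misses \<open>D\<close>; it is finite by
    \<open>cov\<close>.\<close>
  define D where "D = nfold_sumset h B"
  define M where "M = - {nmul i e + d | i d. d \<in> nfold_sumset h B}"
  have DS: "D \<subseteq> nfold_sumset (Suc h) B" unfolding D_def by (simp add: nfold_sumset_le_mono zero)
  have step: "finite ((+) b ` D - D)" if "b \<in> B" for b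
  proof -
    \<comment> \<open>Outside \<open>M\<close>, a point \<open>y\<close> of \<open>b + D\<close>
      shares its coset with some \<open>d\<close> in \<open>D\<close>; both lie in
      \<open>(h + 1)B\<close>, so \<open>y = d\<close>.\<close>
    have "(+) b ` D - D \<subseteq> M"
    proof
      fix y assume y: "y \<in> (+) b ` D - D"
      then have yS: "y \<in> nfold_sumset (Suc h) B"
        using that unfolding D_def nfold_sumset_Suc by blast
      show "y \<in> M"
      proof (rule ccontr)
        assume "y \<notin> M"
        then obtain i d where id: "y = nmul i e + d" "d \<in> D" by (auto simp: M_def D_def)
        have "y = d + nmul (i mod p) e" using id by (simp add: nmul_mod add.commute)
        moreover have "i mod p \<noteq> 0"
        proof
          assume "i mod p = 0"
          with calculation id(2) y show False by simp
        qed
        ultimately show False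
          using False yS DS id(2) p_gt_1 by (metis mod_less_divisor neq0_conv not_less_zero subsetD)
      qed
    qed
    then show ?thesis using cov finite_subset unfolding M_def by blast
  qed
  \<comment> \<open>Almost invariance of \<open>D\<close> under translation passes from the elements
    of \<open>B\<close> to all their sums, so by \<open>cofinite_nfold_double\<close> to
    \<open>e\<close>.\<close>
  have inv: "finite ((+) g ` D - D)" if "g \<in> nfold_sumset k B" for g k
    using that
  proof (induction k arbitrary: g)
    case (Suc k)
    then obtain b y where "b \<in> B" "y \<in> nfold_sumset k B" and g: "g = b + y"
      by (auto simp: nfold_sumset_Suc)
    then have "finite ((+) b ` ((+) y ` D - D) \<union> ((+) b ` D - D))"
      using step Suc.IH by blast
    moreover have "(+) g ` D - D \<subseteq> (+) b ` ((+) y ` D - D) \<union> ((+) b ` D - D)"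
      by (auto simp: g add.assoc)
    ultimately show ?case using finite_subset by blast
  qed auto
  have "finite ((+) e ` D - D)"
    using inv cofinite_nfold_double[OF basis] by blast
  \<comment> \<open>A common point would give two points of \<open>D\<close> differing by
    \<open>e\<close>, the excluded case \<open>k = 1\<close>.\<close>
  moreover have "(+) e ` D \<inter> D = {}"
    using False DS p_gt_1 by (auto simp: add.commute[of e] dest!: spec[of _ "Suc 0"]; fastforce)
  ultimately have "finite ((+) e ` D)" by (simp add: Diff_triv)
  then have "finite D" by (simp add: finite_image_iff)
  \<comment> \<open>The translates of \<open>D\<close> along the line cover the complement of the
    finite set \<open>M\<close>, so they cannot be finite in an infinite group.\<close>
  then have "finite (\<Union>i<p. (+) (nmul i e) ` D)" by blast
  moreover have "- M \<subseteq> (\<Union>i<p. (+) (nmul i e) ` D)"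
  proof
    fix y assume "y \<in> - M"
    then obtain i d where "y = nmul i e + d" "d \<in> D" by (auto simp: M_def D_def)
    then have "y = nmul (i mod p) e + d" "d \<in> D" "i mod p < p" using p_gt_1 by (auto simp: nmul_mod)
    then show "y \<in> (\<Union>i<p. (+) (nmul i e) ` D)" by blast
  qed
  ultimately have "finite (- M)" using finite_subset by blast
  with cov have "finite (M \<union> - M)" unfolding M_def by blast
  with infinite_UNIV show ?thesis by (simp add: Compl_partition)
qed

text \<open>Translation preserves cofiniteness of sumsets, so \<open>A - {a}\<close> may be moved to
  contain 0, where shorter sums are also longer ones.\<close>

lemma X_fun_upper: "X_fun TYPE('a) h \<le> enat (p * h + p - 1)"
  unfolding X_fun_def
proof (rule Sup_least, safe)
  fix A :: "'a set" and a
  assume "almost_equal (nfold_sumset h A) UNIV" "a \<in> regular_elements A"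
  then have hA: "finite (- nfold_sumset h A)" and "is_basis (A - {a})"
    by (auto simp: almost_equal_UNIV regular_elements_def)
  then obtain m where m: "m > 0" "finite (- nfold_sumset m (A - {a}))" by (auto simp: is_basis_iff)
  have "nfold_sumset m {} = ({} :: 'a set)" using m(1) by (cases m) (auto simp: nfold_sumset_Suc)
  with m(2) infinite_UNIV obtain b where b: "b \<in> A - {a}" by (cases "A - {a} = {}") auto
  define B where "B = (+) (- b) ` (A - {a})"
  define C where "C = {nmul i (b - a) + d | i d. d \<in> nfold_sumset h B}"
  have "nfold_sumset h A \<subseteq> (+) (nmul h a) ` C"
  proof
    fix x assume "x \<in> nfold_sumset h A"
    from nfold_sumset_insert_subset[OF b this] show "x \<in> (+) (nmul h a) ` C"
      unfolding C_def B_def by (auto simp: add.assoc)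
  qed
  then have "finite (- ((+) (nmul h a) ` C))" using hA by (meson Compl_anti_mono finite_subset)
  then have "finite (- C)" by (simp add: finite_compl_translate)
  moreover have "0 \<in> B" using b unfolding B_def by force
  moreover have "finite (- nfold_sumset m B)"
    using m(2) unfolding B_def nfold_sumset_translate finite_compl_translate .
  ultimately have "finite (- nfold_sumset (p * h + p - 1) B)"
    unfolding C_def by (intro cofinite_of_cofinite_mod_line[where e = "b - a"])
  then have "finite (- nfold_sumset (p * h + p - 1) (A - {a}))"
    unfolding B_def nfold_sumset_translate finite_compl_translate .
  then show "ord_star (A - {a}) \<le> enat (p * h + p - 1)"
    using p_gt_1 by (intro ord_star_le) auto
qed

section \<open>Dual systems\<close>

text \<open>Homomorphisms to \<open>\<int>/p\<close>, with values represented by the least residues.\<close>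

definition functional :: "('a \<Rightarrow> nat) \<Rightarrow> bool" where
  "functional c \<longleftrightarrow> (\<forall>x. c x < p) \<and> (\<forall>x y. c (x + y) = (c x + c y) mod p)"

lemma functional_zero: "functional c \<Longrightarrow> c 0 = 0"
proof -
  assume "functional c"
  then have "c 0 < p" "c (0 + 0) = (c 0 + c 0) mod p" by (auto simp only: functional_def)
  then show "c 0 = 0" by (cases "c 0 + c 0 < p") (auto simp: mod_if split: if_splits)
qed

lemma functional_nmul: "functional c \<Longrightarrow> c (nmul k x) = (k * c x) mod p"
  by (induction k) (simp_all add: functional_zero nmul_Suc functional_def mod_simps)

lemma functional_sum:
  assumes "functional c" "finite S"
  shows "c (sum f S) = (\<Sum>i\<in>S. c (f i)) mod p"
  using assms(2)
  by (induction S rule: finite_induct)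
    (use assms(1) in \<open>auto simp: functional_zero functional_def mod_simps\<close>)

lemma separating_functional:
  assumes W: "0 \<in> W" "\<And>x y. x \<in> W \<Longrightarrow> y \<in> W \<Longrightarrow> x + y \<in> W" and u: "u \<notin> W"
  obtains c where "functional c" "c u = 1" "\<And>x. x \<in> W \<Longrightarrow> c x = 0"
proof -
  \<comment> \<open>The exponent is finite, so an additively closed set containing \<open>0\<close> is a subgroup;
    a maximal one avoiding \<open>u\<close> is a complement of the line spanned by \<open>u\<close>.\<close>
  define \<S> where "\<S> = {S. W \<subseteq> S \<and> (\<forall>x\<in>S. \<forall>y\<in>S. x + y \<in> S) \<and> u \<notin> S}"
  have "\<exists>S\<in>\<S>. \<forall>X\<in>\<S>. S \<subseteq> X \<longrightarrow> X = S"
  proof (rule subset_Zorn_nonempty)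
    show "\<S> \<noteq> {}" using W u unfolding \<S>_def by blast
    fix \<C> assume C: "\<C> \<noteq> {}" "subset.chain \<S> \<C>"
    have "x + y \<in> \<Union>\<C>" if xy: "x \<in> \<Union>\<C>" "y \<in> \<Union>\<C>" for x y
    proof -
      obtain X Y where XY: "X \<in> \<C>" "x \<in> X" "Y \<in> \<C>" "y \<in> Y" using xy by blast
      with C(2) have "X \<subseteq> Y \<or> Y \<subseteq> X" "X \<in> \<S>" "Y \<in> \<S>" unfolding subset_chain_def by auto
      with XY show ?thesis unfolding \<S>_def by blast
    qed
    then show "\<Union>\<C> \<in> \<S>" using C unfolding \<S>_def subset_chain_def by blast
  qed
  then obtain S where S: "S \<in> \<S>" and max: "\<And>X. X \<in> \<S> \<Longrightarrow> S \<subseteq> X \<Longrightarrow> X = S" by blast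
  have WS: "W \<subseteq> S" and S_add: "\<And>x y. x \<in> S \<Longrightarrow> y \<in> S \<Longrightarrow> x + y \<in> S" and uS: "u \<notin> S"
    using S unfolding \<S>_def by auto
  have S0: "0 \<in> S" using WS W by blast
  have S_nmul: "nmul k x \<in> S" if "x \<in> S" for k x
    by (induction k) (use that S0 S_add in \<open>auto simp: nmul_Suc\<close>)
  have S_diff: "x - y \<in> S" if "x \<in> S" "y \<in> S" for x y
    using S_add[OF that(1) S_nmul[OF that(2), of "p - 1"]]
    unfolding uminus_eq_nmul[symmetric] by simp
  \<comment> \<open>By maximality, adjoining the multiples of \<open>x\<close> to \<open>S\<close>
    captures \<open>u\<close>; solving \<open>u = s + nmul k x\<close> for \<open>x\<close> puts
    \<open>x\<close> in the coset of a multiple of \<open>u\<close>.\<close>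
  have ex: "\<exists>j<p. x - nmul j u \<in> S" for x
  proof (cases "x \<in> S")
    case True
    then show ?thesis using p_gt_1 by (intro exI[of _ 0]) auto
  next
    case False
    define T where "T = {s + nmul k x | s k. s \<in> S}"
    have "S \<subseteq> T" unfolding T_def by (force intro: exI[of _ 0])
    moreover have "x \<in> T" unfolding T_def using S0 by (force intro: exI[of _ 0] exI[of _ "Suc 0"])
    moreover have "a + b \<in> T" if ab: "a \<in> T" "b \<in> T" for a b
    proof -
      obtain s k t l where "a = s + nmul k x" "b = t + nmul l x" "s \<in> S" "t \<in> S"
        using ab unfolding T_def by blast
      then have "a + b = (s + t) + nmul (k + l) x" "s + t \<in> S"
        by (simp_all add: nmul_add algebra_simps S_add)
      then show ?thesis unfolding T_def by blast
    qed
    ultimately have "u \<in> T" using max[of T] False WS unfolding \<S>_def by blast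
    then obtain s k where sk: "u = s + nmul k x" "s \<in> S" unfolding T_def by blast
    have "k mod p \<noteq> 0" using sk uS nmul_mod[of k x] by (metis add.right_neutral nmul_0)
    then obtain l where l: "\<And>y::'a. nmul l (nmul (k mod p) y) = y"
      using nmul_inverse[of "k mod p"] p_gt_1 by auto
    have "nmul l u = nmul l s + x" using l[of x] sk(1) by (simp add: nmul_add_right nmul_mod)
    then have "x - nmul l u = 0 - nmul l s" by simp
    also have "\<dots> \<in> S" by (intro S_diff S_nmul S0 sk)
    finally have "x - nmul (l mod p) u \<in> S" by (simp add: nmul_mod)
    then show ?thesis using p_gt_1 by (intro exI[of _ "l mod p"]) auto
  qed
  \<comment> \<open>Two coordinates would place a nonzero multiple of \<open>u\<close> in
    \<open>S\<close>, and hence \<open>u\<close> itself.\<close>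
  have uniq_less: False if ij: "i < j" "j < p" and "x - nmul i u \<in> S" "x - nmul j u \<in> S" for i j x
  proof -
    have "nmul (j - i) u = (x - nmul i u) - (x - nmul j u)"
      using nmul_add[of i "j - i" u] that(1) by (simp add: algebra_simps)
    then have *: "nmul (j - i) u \<in> S" using S_diff[OF that(3,4)] by simp
    obtain l where "\<And>y::'a. nmul l (nmul (j - i) y) = y"
      using nmul_inverse[of "j - i"] ij by (metis less_imp_diff_less zero_less_diff)
    then have "u \<in> S" using S_nmul[OF *, of l] by simp
    with uS show False by blast
  qed
  have uniq: "i = j" if "i < p" "j < p" "x - nmul i u \<in> S" "x - nmul j u \<in> S" for i j x
    using uniq_less[of i j x] uniq_less[of j i x] that by (meson linorder_neqE_nat)
  from ex have "\<forall>x. \<exists>j. j < p \<and> x - nmul j u \<in> S" by blast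
  \<comment> \<open>\<open>c x\<close> is the unique \<open>u\<close>-coordinate of \<open>x\<close>
    modulo \<open>S\<close>; uniqueness makes it additive.\<close>
  from choice[OF this] obtain c where c: "\<And>x. c x < p" "\<And>x. x - nmul (c x) u \<in> S" by blast
  have "c (x + y) = (c x + c y) mod p" for x y
  proof (rule uniq)
    show "x + y - nmul ((c x + c y) mod p) u \<in> S"
      using S_add[OF c(2) c(2), of x y] by (simp add: nmul_mod nmul_add algebra_simps)
  qed (use c p_gt_1 in auto)
  then have "functional c" using c(1) by (simp add: functional_def)
  moreover have "c u = 1" 
    using c[of u] p_gt_1 S0 by (intro uniq[of _ _ u]) simp_all
  moreover have "c x = 0" if "x \<in> W" for x 
    using c[of x] p_gt_1 WS that by (intro uniq[of _ _ x]) auto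
  ultimately show ?thesis using that by blast
qed

text \<open>The coordinate functions live on the whole group, so the common kernel of the
  \<open>c i\<close> is a complement of the span of the \<open>v i\<close>.\<close>

definition dual_system :: "nat \<Rightarrow> (nat \<Rightarrow> 'a) \<Rightarrow> (nat \<Rightarrow> 'a \<Rightarrow> nat) \<Rightarrow> bool" where
  "dual_system n v c \<longleftrightarrow> (\<forall>i<n. functional (c i)) \<and>
     (\<forall>i<n. \<forall>j<n. c i (v j) = (if i = j then 1 else 0))"

definition lincomb :: "nat \<Rightarrow> (nat \<Rightarrow> 'a) \<Rightarrow> (nat \<Rightarrow> nat) \<Rightarrow> 'a" where
  "lincomb n v k = (\<Sum>i<n. nmul (k i) (v i))"

lemma lincomb_add: "lincomb n v (\<lambda>i. k i + l i) = lincomb n v k + lincomb n v l"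
  by (simp add: lincomb_def nmul_add sum.distrib)

lemma lincomb_cong: "(\<And>i. i < n \<Longrightarrow> k i = l i) \<Longrightarrow> lincomb n v k = lincomb n v l"
  by (simp add: lincomb_def)

lemma lincomb_mod: "lincomb n v (\<lambda>i. k i mod p) = lincomb n v k"
  by (simp add: lincomb_def nmul_mod)

lemma lincomb_zero: "lincomb n v (\<lambda>i. 0) = 0"
  by (simp add: lincomb_def)

lemma lincomb_delta: "j < n \<Longrightarrow> lincomb n v (\<lambda>i. if i = j then 1 else 0) = v j"
  by (simp add: lincomb_def if_distrib[of "\<lambda>k. nmul k _"] cong: if_cong)

lemma finite_lincombs: "finite {lincomb n v k | k. \<forall>i<n. k i < p}"
proof -
  have "{lincomb n v k | k. \<forall>i<n. k i < p} \<subseteq> lincomb n v ` (PiE {..<n} (\<lambda>_. {..<p}))"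
  proof safe
    fix k assume k: "\<forall>i<n. k i < p"
    have "lincomb n v k = lincomb n v (restrict k {..<n})" by (rule lincomb_cong) simp
    with k show "lincomb n v k \<in> lincomb n v ` (PiE {..<n} (\<lambda>_. {..<p}))" by auto
  qed
  moreover have "finite (PiE {..<n} (\<lambda>_. {..<p}))" by (intro finite_PiE) auto
  ultimately show ?thesis by (meson finite_imageI finite_subset)
qed

lemma dual_system_lincomb:
  assumes "dual_system n v c" "i < n"
  shows "c i (lincomb n v k) = k i mod p"
proof -
  have f: "functional (c i)" and d: "\<And>j. j < n \<Longrightarrow> c i (v j) = (if i = j then 1 else 0)"
    using assms by (auto simp: dual_system_def)
  have "c i (lincomb n v k) = (\<Sum>j<n. (k j * c i (v j)) mod p) mod p"
    unfolding lincomb_def by (simp add: functional_sum[OF f] functional_nmul[OF f])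
  also have "\<dots> = (\<Sum>j<n. k j * c i (v j)) mod p" by (rule mod_sum_eq)
  also have "(\<Sum>j<n. k j * c i (v j)) = (\<Sum>j<n. if i = j then k j else 0)"
    by (intro sum.cong) (auto simp: d)
  also have "\<dots> = k i" using assms(2) by simp
  finally show ?thesis .
qed

text \<open>Induction on \<open>n\<close>: the span of finitely many vectors is finite, so some
  vector lies outside it, and \<open>separating_functional\<close> supplies the new
  coordinate.\<close>

lemma dual_system_exists: "\<exists>v c. dual_system n v c"
proof (induction n)
  case 0
  then show ?case by (simp add: dual_system_def)
next
  case (Suc n)
  then obtain v c where vc: "dual_system n v c" by blast
  have cf: "functional (c i)" if "i < n" for i using vc that by (simp add: dual_system_def)
  \<comment> \<open>The span of the \<open>v i\<close>, written as the fixed points of the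
    projection onto it.\<close>
  define W where "W = {x. x = lincomb n v (\<lambda>i. c i x)}"
  have W0: "0 \<in> W"
    using lincomb_cong[of n "\<lambda>i. c i 0" "\<lambda>i. 0" v] functional_zero[OF cf]
    by (simp add: W_def lincomb_zero)
  have W_add: "x + y \<in> W" if "x \<in> W" "y \<in> W" for x y
  proof -
    have "lincomb n v (\<lambda>i. c i (x + y)) = lincomb n v (\<lambda>i. (c i x + c i y) mod p)"
      using cf by (intro lincomb_cong) (simp add: functional_def)
    also have "\<dots> = x + y" using that by (simp add: lincomb_mod lincomb_add W_def)
    finally show ?thesis by (simp add: W_def)
  qed
  have "W \<subseteq> {lincomb n v k | k. \<forall>i<n. k i < p}"
    using cf by (auto simp: W_def functional_def)
  then have "finite W" using finite_lincombs finite_subset by blast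
  with infinite_UNIV obtain y where y: "y \<notin> W" by (metis UNIV_eq_I)
  \<comment> \<open>\<open>p - c i y\<close> is the negative of \<open>c i y\<close> modulo
    \<open>p\<close>, so \<open>u\<close> is \<open>y\<close> minus its projection and all old
    coordinates vanish on it.\<close>
  define u where "u = y + lincomb n v (\<lambda>i. p - c i y)"
  have cu: "c i u = 0" if "i < n" for i
  proof -
    have "c i u = (c i y + (p - c i y) mod p) mod p"
      using cf[OF that] unfolding u_def by (simp add: functional_def dual_system_lincomb[OF vc that])
    also have "\<dots> = (c i y + (p - c i y)) mod p" by (simp add: mod_simps)
    also have "\<dots> = 0" using cf[OF that] by (simp add: functional_def less_imp_le)
    finally show ?thesis .
  qed
  have "u \<notin> W"
  proof
    assume "u \<in> W"
    then have "u = 0" using lincomb_cong[of n "\<lambda>i. c i u" "\<lambda>i. 0" v] cu by (simp add: W_def lincomb_zero)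
    moreover have "lincomb n v (\<lambda>i. c i y) + lincomb n v (\<lambda>i. p - c i y) = lincomb n v (\<lambda>i. p)"
      unfolding lincomb_add[symmetric] using cf
      by (intro lincomb_cong) (simp add: functional_def less_imp_le)
    then have "lincomb n v (\<lambda>i. c i y) + lincomb n v (\<lambda>i. p - c i y) = 0"
      by (simp add: lincomb_def)
    ultimately have "y = lincomb n v (\<lambda>i. c i y)" unfolding u_def by (metis add_right_cancel)
    with y show False by (simp add: W_def)
  qed
  then obtain d where d: "functional d" "d u = 1" "\<And>x. x \<in> W \<Longrightarrow> d x = 0"
    using separating_functional[OF W0 W_add] by blast
  have "v j \<in> W" if "j < n" for j
  proof -
    have "lincomb n v (\<lambda>i. c i (v j)) = lincomb n v (\<lambda>i. if i = j then 1 else 0)"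
      using vc that by (intro lincomb_cong) (simp add: dual_system_def)
    then show ?thesis using lincomb_delta[OF that, of v] by (simp add: W_def)
  qed
  then have "dual_system (Suc n) (v(n := u)) (c(n := d))"
    using vc d cu by (auto simp: dual_system_def less_Suc_eq)
  then show ?case by blast
qed

section \<open>The lower bound\<close>

lemma sum_shift_mod: "(\<Sum>k<p. (x + k) mod p) = p * (p - 1) div 2"
proof -
  have "inj_on (\<lambda>k. (x + k) mod p) {..<p}"
  proof (rule inj_onI)
    fix k l assume "k \<in> {..<p}" "l \<in> {..<p}" "(x + k) mod p = (x + l) mod p"
    then have "[x + k = x + l] (mod p)" by (simp add: cong_def)
    then have "[k = l] (mod p)" by (simp add: cong_add_lcancel_nat)
    with \<open>k \<in> _\<close> \<open>l \<in> _\<close> show "k = l" by (simp add: cong_def)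
  qed
  moreover have "(\<lambda>k. (x + k) mod p) ` {..<p} \<subseteq> {..<p}" using p_gt_1 by auto
  ultimately have "bij_betw (\<lambda>k. (x + k) mod p) {..<p} {..<p}"
    by (simp add: bij_betw_def endo_inj_surj)
  then have "(\<Sum>k<p. (x + k) mod p) = \<Sum>{..<p}"
    using sum.reindex_bij_betw[of _ _ _ "\<lambda>k. k"] by blast
  also have "\<dots> = p * (p - 1) div 2"
    using Sum_Ico_nat[of 0 p] by (simp add: atLeast0LessThan)
  finally show ?thesis .
qed

text \<open>Averaging: by \<open>sum_shift_mod\<close> each \<open>i\<close> contributes
  \<open>p * (p - 1) div 2\<close> over all shifts, so the doubled sums have mean
  \<open>n * (p - 1)\<close> over \<open>k\<close>.\<close>

lemma exists_cheap_shift: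
  "\<exists>k<p. 2 * (\<Sum>i<n. (f i + k) mod p) \<le> n * (p - 1)"
proof (rule ccontr)
  assume "\<not> ?thesis"
  then have gt: "n * (p - 1) < 2 * (\<Sum>i<n. (f i + k) mod p)" if "k < p" for k
    using that by force
  have "p * (n * (p - 1)) = (\<Sum>k<p. n * (p - 1))" by simp
  also have "\<dots> < (\<Sum>k<p. 2 * (\<Sum>i<n. (f i + k) mod p))"
    using gt p_gt_1 by (intro sum_strict_mono) auto
  also have "\<dots> = 2 * (\<Sum>i<n. \<Sum>k<p. (f i + k) mod p)"
    by (subst sum.swap) (simp add: sum_distrib_left)
  also have "\<dots> = n * (2 * (p * (p - 1) div 2))" by (simp add: sum_shift_mod)
  also have "\<dots> = n * (p * (p - 1))" using p_gt_1 by (simp add: even_two_times_div_two)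
  finally show False by (simp add: mult.left_commute)
qed

text \<open>An element is built from \<open>c i x\<close> copies of each \<open>v i\<close> and one
  element of \<open>I\<close>, which explains the \<open>Suc\<close>. The bound on
  \<open>ord_star\<close> from below takes infinitely many expensive elements, since the order
  ignores finite sets.\<close>

lemma ord_star_dual_system:
  assumes vc: "dual_system n v c"
  defines "I \<equiv> {x. \<forall>i<n. c i x = 0}"
  defines "B \<equiv> I \<union> v ` {..<n}"
  shows "x \<in> nfold_sumset (Suc (\<Sum>i<n. c i x)) B"
    and "nfold_sumset (Suc (n * (p - 1))) B = UNIV"
    and "enat (Suc (n * (p - 1))) \<le> ord_star B"
proof -
  have cf: "functional (c i)" if "i < n" for i using vc that by (simp add: dual_system_def)
  have c_less: "c i x < p" if "i < n" for i x using cf[OF that] by (simp add: functional_def)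
  have c_add: "c i (x + y) = (c i x + c i y) mod p" if "i < n" for i x y
    using cf[OF that] by (simp add: functional_def)
  \<comment> \<open>The projection onto \<open>I\<close> along the span of the
    \<open>v i\<close>.\<close>
  define w where "w x = x - lincomb n v (\<lambda>i. c i x)" for x
  have wI: "w x \<in> I" for x
  proof -
    have "c i (w x) = 0" if i: "i < n" for i
    proof -
      have "c i (w x + lincomb n v (\<lambda>i. c i x)) = (c i (w x) + c i x) mod p"
        using c_less[OF i] by (simp add: c_add i dual_system_lincomb[OF vc])
      then have "c i x = (c i (w x) + c i x) mod p" by (simp add: w_def)
      then show ?thesis
        using c_less[OF i, of x] c_less[OF i, of "w x"] by (auto simp: mod_if split: if_splits)
    qed
    then show ?thesis by (simp add: I_def)
  qed
  have w_add: "w (x + y) = w x + w y" for x y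
  proof -
    have "lincomb n v (\<lambda>i. c i (x + y)) = lincomb n v (\<lambda>i. (c i x + c i y) mod p)"
      by (intro lincomb_cong) (simp add: c_add)
    then show ?thesis by (simp add: w_def lincomb_mod lincomb_add algebra_simps)
  qed
  have w_I: "w x = x" if "x \<in> I" for x
    using lincomb_cong[of n "\<lambda>i. c i x" "\<lambda>i. 0" v] that by (simp add: w_def I_def lincomb_zero)
  have "0 \<in> I" using cf by (simp add: I_def functional_zero)
  then have "0 \<in> B" by (simp add: B_def)
  show rep: "x \<in> nfold_sumset (Suc (\<Sum>i<n. c i x)) B" for x
  proof -
    have "lincomb n v (\<lambda>i. c i x) \<in> nfold_sumset (\<Sum>i<n. c i x * 1) B"
      unfolding lincomb_def
      by (intro nfold_sumset_sum nmul_in_nfold_sumset) (auto simp: B_def)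
    moreover have "w x \<in> B" using wI by (simp add: B_def)
    ultimately have "w x + lincomb n v (\<lambda>i. c i x) \<in> nfold_sumset (Suc (\<Sum>i<n. c i x)) B"
      unfolding nfold_sumset_Suc by auto
    then show ?thesis by (simp add: w_def)
  qed
  have "(\<Sum>i<n. c i x) \<le> n * (p - 1)" for x
    using sum_bounded_above[of "{..<n}" "\<lambda>i. c i x" "p - 1"] c_less
    by (simp add: less_Suc_eq_le[symmetric]) (metis One_nat_def Suc_pred c_less gr_implies_not0 neq0_conv)
  then show "nfold_sumset (Suc (n * (p - 1))) B = UNIV"
    using rep nfold_sumset_le_mono[OF \<open>0 \<in> B\<close>] by (metis Suc_le_mono UNIV_eq_I subsetD)
  \<comment> \<open>A subadditive lower bound for the number of summands from \<open>B\<close> needed to represent \<open>x\<close>.\<close>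
  define L where "L x = (\<Sum>i<n. c i x) + (if w x = 0 then 0 else 1)" for x
  have L_add: "L (x + y) \<le> L x + L y" for x y
  proof -
    have "(\<Sum>i<n. c i (x + y)) \<le> (\<Sum>i<n. c i x + c i y)"
      by (intro sum_mono) (simp add: c_add)
    then show ?thesis by (auto simp: L_def w_add sum.distrib)
  qed
  have L_B: "L b \<le> 1" if b: "b \<in> B" for b
  proof (cases "b \<in> I")
    case True
    then show ?thesis by (simp add: L_def I_def)
  next
    case False
    then obtain j where j: "j < n" "b = v j" using b by (auto simp: B_def)
    have cv: "c i b = (if i = j then 1 else 0)" if "i < n" for i
      using vc j that by (simp add: dual_system_def)
    then have "lincomb n v (\<lambda>i. c i b) = lincomb n v (\<lambda>i. if i = j then 1 else 0)"
      by (intro lincomb_cong)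
    then have "w b = 0" unfolding w_def using lincomb_delta[OF j(1), of v] j(2) by simp
    moreover have "(\<Sum>i<n. c i b) = 1" using cv j(1) by simp
    ultimately show ?thesis by (simp add: L_def)
  qed
  have "w 0 = 0" using w_I \<open>0 \<in> I\<close> by blast
  have L_le: "L x \<le> k" if "x \<in> nfold_sumset k B" for x k
    using that
  proof (induction k arbitrary: x)
    case 0
    then show ?case using \<open>w 0 = 0\<close> \<open>0 \<in> I\<close> by (simp add: L_def I_def)
  next
    case (Suc k)
    then obtain b y where "b \<in> B" "y \<in> nfold_sumset k B" "x = b + y"
      by (auto simp: nfold_sumset_Suc)
    then show ?case using L_add[of b y] L_B[of b] Suc.IH[of y] by simp
  qed
  \<comment> \<open>Otherwise the group would be the sum of two finite sets, \<open>I\<close> and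
    the span of the \<open>v i\<close>.\<close>
  have "infinite I"
  proof
    let ?F = "{lincomb n v k | k. \<forall>i<n. k i < p}"
    assume "finite I"
    then have fin: "finite ((\<lambda>(a, b). a + b) ` (I \<times> ?F))"
      by (intro finite_imageI finite_cartesian_product finite_lincombs)
    have "x \<in> (\<lambda>(a, b). a + b) ` (I \<times> ?F)" for x
      using wI[of x] c_less by (intro image_eqI[of _ _ "(w x, lincomb n v (\<lambda>i. c i x))"]) (auto simp: w_def)
    then have "UNIV \<subseteq> (\<lambda>(a, b). a + b) ` (I \<times> ?F)" by blast
    with fin infinite_UNIV show False using finite_subset by blast
  qed
  \<comment> \<open>All coordinates of \<open>s\<close> are maximal, so \<open>s + y\<close> with
    nonzero \<open>y\<close> in \<open>I\<close> attains the maximum of \<open>L\<close>.\<close>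
  define s where "s = lincomb n v (\<lambda>i. p - 1)"
  have cs: "c i s = p - 1" if "i < n" for i
    using dual_system_lincomb[OF vc that] p_gt_1 by (simp add: s_def)
  have "w s = 0"
    using lincomb_cong[of n "\<lambda>i. c i s" "\<lambda>i. p - 1" v] cs by (simp add: w_def s_def)
  have L_s: "L (s + y) = Suc (n * (p - 1))" if "y \<in> I - {0}" for y
  proof -
    have "c i (s + y) = p - 1" if "i < n" for i
      using c_add[OF that] cs[OF that] \<open>y \<in> I - {0}\<close> that p_gt_1 by (simp add: I_def)
    moreover have "w (s + y) \<noteq> 0" using that \<open>w s = 0\<close> by (simp add: w_add w_I)
    ultimately show ?thesis by (simp add: L_def)
  qed
  show "enat (Suc (n * (p - 1))) \<le> ord_star B"
  proof (rule le_ord_star, rule ccontr)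
    fix k assume k: "finite (- nfold_sumset k B)" "\<not> Suc (n * (p - 1)) \<le> k"
    have "(+) s ` (I - {0}) \<subseteq> - nfold_sumset k B" 
    proof safe
      fix y assume "y \<in> I" "y \<noteq> 0" "s + y \<in> nfold_sumset k B"
      then show False using L_s[of y] L_le[of "s + y" k] k(2) by simp
    qed
    then have "finite ((+) s ` (I - {0}))" using k(1) finite_subset by blast
    with \<open>infinite I\<close> show False by (simp add: finite_image_iff)
  qed
qed

text \<open>The budget \<open>h\<close> pays for at most \<open>n * (p - 1) / 2\<close> vectors
  \<open>v i\<close>, one element of the kernel and at most \<open>p - 1\<close> copies of
  \<open>- e\<close>. For \<open>n = 1\<close> and \<open>p = 2\<close> the element
  \<open>- e\<close> would already be \<open>v 0\<close>, hence the exclusion.\<close>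

lemma X_fun_ge_dual:
  assumes n: "0 < n" "n = 1 \<Longrightarrow> p \<noteq> 2" and h: "p \<le> h" "n * (p - 1) \<le> 2 * (h - p)"
  shows "enat (Suc (n * (p - 1))) \<le> X_fun TYPE('a) h"
proof -
  obtain v c where vc: "dual_system n v c" using dual_system_exists by blast
  define B where "B = {x. \<forall>i<n. c i x = 0} \<union> v ` {..<n}"
  note B = ord_star_dual_system[OF vc, folded B_def]
  have cf: "functional (c i)" if "i < n" for i using vc that by (simp add: dual_system_def)
  define e where "e = lincomb n v (\<lambda>i. 1)"
  have ce: "c i (x + nmul k e) = (c i x + k) mod p" if "i < n" for i x k
  proof -
    have "c i e = 1" using dual_system_lincomb[OF vc that] p_gt_1 by (simp add: e_def)
    then show ?thesis using functional_nmul[OF cf[OF that], of k e] cf[OF that]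
      by (simp add: functional_def mod_simps)
  qed
  have cme: "c i (- e) = p - 1" if "i < n" for i
    using ce[OF that, of 0 "p - 1"] functional_zero[OF cf[OF that]] p_gt_1
    by (simp add: uminus_eq_nmul)
  have "- e \<notin> B"
  proof
    assume "- e \<in> B"
    then consider "\<forall>i<n. c i (- e) = 0" | j where "j < n" "- e = v j" by (auto simp: B_def)
    then show False
    proof cases
      case 1
      then show False using cme[OF n(1)] n(1) p_gt_1 by simp
    next
      case 2
      \<comment> \<open>At \<open>i = j\<close> this forces \<open>p = 2\<close>; then
        \<open>n > 1\<close>, and another index gives \<open>0 = p - 1\<close>.\<close>
      have *: "(if i = j then 1 else 0) = p - 1" if "i < n" for i
        using vc that 2 cme[OF that] by (simp add: dual_system_def)
      from *[of j] 2 p_gt_1 have "p = 2" by simp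
      with n have "1 < n" by (cases "n = 1") auto
      then obtain i where "i < n" "i \<noteq> j" by (cases "j = 0") auto
      with *[of i] p_gt_1 show False by simp
    qed
  qed
  define A where "A = insert (- e) B"
  have AB: "A - {- e} = B" using \<open>- e \<notin> B\<close> by (simp add: A_def)
  have "0 \<in> B" using cf by (simp add: B_def functional_zero)
  have "x \<in> nfold_sumset h A" for x
  proof -
    \<comment> \<open>Move \<open>x\<close> along the line to a point with small coordinate sum and
      return with \<open>k\<close> copies of \<open>- e\<close>.\<close>
    obtain k where k: "k < p" "2 * (\<Sum>i<n. (c i x + k) mod p) \<le> n * (p - 1)"
      using exists_cheap_shift[where f = "\<lambda>i. c i x" and n = n] by blast
    let ?m = "\<Sum>i<n. c i (x + nmul k e)"
    have "?m = (\<Sum>i<n. (c i x + k) mod p)" by (intro sum.cong) (auto simp: ce)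
    with k(2) h(2) have m: "?m \<le> h - p" by linarith
    have "x + nmul k e \<in> nfold_sumset (Suc ?m) A"
      using B(1)[of "x + nmul k e"] nfold_sumset_mono[of B A] by (auto simp: A_def)
    moreover have "nmul k (- e) \<in> nfold_sumset (k * 1) A"
      by (rule nmul_in_nfold_sumset) (simp add: A_def)
    ultimately have "(x + nmul k e) + nmul k (- e) \<in> nfold_sumset (Suc ?m + k * 1) A"
      by (rule nfold_sumset_add)
    moreover have "Suc ?m + k * 1 \<le> h" using m k(1) h(1) by linarith
    moreover have "0 \<in> A" using \<open>0 \<in> B\<close> by (simp add: A_def)
    ultimately have "(x + nmul k e) + nmul k (- e) \<in> nfold_sumset h A"
      using nfold_sumset_le_mono[of A "Suc ?m + k * 1" h] by (meson subsetD)
    then show ?thesis by (simp add: nmul_minus_right)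
  qed
  then have "nfold_sumset h A = UNIV" by blast
  moreover have "is_basis B" unfolding is_basis_iff
    by (rule exI[of _ "Suc (n * (p - 1))"]) (simp only: B(2), simp)
  then have "- e \<in> regular_elements A" by (simp add: regular_elements_def AB) (simp add: A_def)
  ultimately have "ord_star (A - {- e}) \<le> X_fun TYPE('a) h" by (intro X_fun_ge) auto
  with B(3) AB show ?thesis by simp
qed

text \<open>Removing 0 from the whole group gives this trivial bound; it serves the borderline case
  of \<open>X_fun_lower\<close> where the claimed bound is 1.\<close>

lemma X_fun_ge_1:
  assumes "0 < h" shows "1 \<le> X_fun TYPE('a) h"
proof -
  have "x \<in> nfold_sumset h UNIV" for x :: 'a
    using nfold_sumset_le_mono[of UNIV "Suc 0" h] assms by auto
  then have "finite (- nfold_sumset h (UNIV :: 'a set))" by (simp add: finite_subset[of _ "{}"] subset_iff)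
  moreover have "is_basis (UNIV - {0 :: 'a})" unfolding is_basis_iff
    by (rule exI[of _ "Suc 0"]) simp
  then have "0 \<in> regular_elements (UNIV :: 'a set)" by (simp add: regular_elements_def)
  ultimately have "ord_star (UNIV - {0 :: 'a}) \<le> X_fun TYPE('a) h" by (rule X_fun_ge)
  moreover have "enat 1 \<le> ord_star (UNIV - {0 :: 'a})" by (rule le_ord_star) simp
  ultimately show ?thesis by (simp add: one_enat_def)
qed

text \<open>In the first case truncated subtraction makes the bound 0, in the second it is 1.
  Otherwise take the largest \<open>n\<close> with \<open>n * (p - 1) \<le> 2 * (h - p)\<close>: the
  remainder is at most \<open>p - 2\<close>, and \<open>2 * (h - p) + 1 - (p - 2)\<close> is the
  claimed bound.\<close>

lemma X_fun_lower: "enat (2 * h + 3 - 3 * p) \<le> X_fun TYPE('a) h"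
proof -
  consider "2 * h + 3 \<le> 3 * p" | "2 * h + 3 = 3 * p + 1" | "3 * p \<le> 2 * h + 1" by linarith
  then show ?thesis
  proof cases
    case 1
    then show ?thesis by (simp add: zero_enat_def[symmetric])
  next
    case 2
    then have "0 < h" using p_gt_1 by linarith
    moreover have "2 * h + 3 - 3 * p = 1" using 2 by linarith
    ultimately show ?thesis using X_fun_ge_1 by (simp add: one_enat_def)
  next
    case 3
    define n where "n = 2 * (h - p) div (p - 1)"
    have ph: "p \<le> h" using 3 p_gt_1 by linarith
    have "n * (p - 1) + 2 * (h - p) mod (p - 1) = 2 * (h - p)"
      unfolding n_def by (rule div_mult_mod_eq)
    moreover have "2 * (h - p) mod (p - 1) < p - 1" using p_gt_1 by simp
    ultimately have n: "n * (p - 1) \<le> 2 * (h - p)" "2 * (h - p) < n * (p - 1) + (p - 1)" by linarith+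
    have "n \<noteq> 0" using n(2) 3 ph by (intro notI) simp
    \<comment> \<open>For \<open>p = 2\<close> and \<open>n = 1\<close> the division estimate would
      give \<open>h < 3\<close>, but here \<open>h\<close> is at least 3.\<close>
    moreover have "p \<noteq> 2" if "n = 1" 
    proof
      assume "p = 2"
      with that n(2) 3 ph show False by simp presburger
    qed
    ultimately have "enat (Suc (n * (p - 1))) \<le> X_fun TYPE('a) h"
      using n(1) ph by (intro X_fun_ge_dual) auto
    moreover have "2 * h + 3 - 3 * p \<le> Suc (n * (p - 1))" using n(2) ph by linarith
    ultimately show ?thesis by (meson enat_ord_simps(1) order_trans)
  qed
qed

end

section \<open>From element orders to the exponent, and the asymptotics for
  \<open>p = 2\<close>\<close>

lemma nmul_exponent:
  fixes x :: "'a::ab_group_add"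
  assumes "prime p" "\<forall>x::'a. x \<noteq> 0 \<longrightarrow> add_order x = p"
  shows "nmul p x = 0"
proof (cases "x = 0")
  case False
  then have ord: "add_order x = p" using assms(2) by blast
  \<comment> \<open>\<open>p\<close> is nonzero, which excludes the default value 0 of
    \<open>add_order\<close>.\<close>
  with assms(1) have ex: "\<exists>n>0. sum_list (replicate n x) = 0"
    by (auto simp: add_order_def split: if_splits)
  then have "p = (LEAST n. 0 < n \<and> sum_list (replicate n x) = 0)"
    using ord by (auto simp: add_order_def)
  with LeastI_ex[OF ex] show ?thesis by (simp add: nmul_def)
qed simp

theorem theorem1p5:
  fixes p :: nat
  assumes "prime p"
    and "infinite (UNIV :: 'a::ab_group_add set)"
    and "\<forall>x::'a. x \<noteq> 0 \<longrightarrow> add_order x = p"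
  shows "(\<forall>h\<ge>p. X_fun TYPE('a) h \<le> enat (p * h + p - 1)) \<and>
         (\<forall>h::nat. real h \<ge> 3 * (real p - 1) / 2 \<longrightarrow>
            X_fun TYPE('a) h \<ge> enat (2 * h + 3 - 3 * p)) \<and>
         (p = 2 \<longrightarrow>
            (\<lambda>h. real (the_enat (X_fun TYPE('a) h))) \<sim>[at_top] (\<lambda>h. 2 * real h))"
proof -
  interpret elementary_abelian p "TYPE('a)"
    using assms(1,2) nmul_exponent[OF assms(1,3)] by unfold_locales
  have "(\<lambda>h. real (the_enat (X_fun TYPE('a) h))) \<sim>[at_top] (\<lambda>h. 2 * real h)" if "p = 2"
  proof (rule asymp_equivI', rule tendsto_sandwich)
    let ?X = "\<lambda>h. the_enat (X_fun TYPE('a) h)"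
    \<comment> \<open>The finite upper bound makes \<open>the_enat\<close> return the actual value;
      \<open>2 * h + 3 - 6\<close> is the truncated form of \<open>2 * h - 3\<close>.\<close>
    have X: "2 * h + 3 - 6 \<le> ?X h \<and> ?X h \<le> 2 * h + 1" for h
    proof -
      have "X_fun TYPE('a) h \<le> enat (2 * h + 1)" "enat (2 * h + 3 - 6) \<le> X_fun TYPE('a) h"
        using X_fun_upper[of h] X_fun_lower[of h] that by simp_all
      then show ?thesis by (cases "X_fun TYPE('a) h") auto
    qed
    have X_le: "real (?X h) \<le> 2 * real h + 1" and X_ge: "2 * real h - 3 \<le> real (?X h)" for h
      using X[of h] by linarith+
    have div: "x / (2 * real h) \<le> y / (2 * real h)" if "x \<le> y" for x y h
      using that by (simp add: divide_right_mono)
    show "\<forall>\<^sub>F h in at_top. 1 - 3 / 2 * (1 / real h) \<le> real (?X h) / (2 * real h)"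
      using eventually_gt_at_top[of 0]
    proof eventually_elim
      case (elim h)
      then have "1 - 3 / 2 * (1 / real h) = (2 * real h - 3) / (2 * real h)"
        by (simp add: field_simps)
      then show ?case using div[OF X_ge] by simp
    qed
    show "\<forall>\<^sub>F h in at_top. real (?X h) / (2 * real h) \<le> 1 + 1 / 2 * (1 / real h)"
      using eventually_gt_at_top[of 0]
    proof eventually_elim
      case (elim h)
      then have "1 + 1 / 2 * (1 / real h) = (2 * real h + 1) / (2 * real h)"
        by (simp add: field_simps)
      then show ?case using div[OF X_le] by simp
    qed
    have "(\<lambda>h. 1 - 3 / 2 * (1 / real h)) \<longlonglongrightarrow> 1 - 3 / 2 * 0"
      by (intro tendsto_intros lim_1_over_n)
    then show "(\<lambda>h. 1 - 3 / 2 * (1 / real h)) \<longlonglongrightarrow> 1" by simp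
    have "(\<lambda>h. 1 + 1 / 2 * (1 / real h)) \<longlonglongrightarrow> 1 + 1 / 2 * 0"
      by (intro tendsto_intros lim_1_over_n)
    then show "(\<lambda>h. 1 + 1 / 2 * (1 / real h)) \<longlonglongrightarrow> 1" by simp
  qed
  with X_fun_upper X_fun_lower show ?thesis by blast
qed

end
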